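(* Let $T_1,T_2\subset \mathsf{Ein}^3$ be Einstein tori with $T_1\neq T_2$. Then $T_1\cap T_2$ is nonempty, and exactly one of the following possibilities occurs: (i) $T_1\cap T_2$ is a union of two photons which intersect in exactly one point; (ii) $T_1\cap T_2$ is a spacelike circle and the intersection is transverse; (iii) $T_1\cap T_2$ is a timelike circle and the intersection is transverse. Moreover, the invariant $\eta(T_1,T_2)$ distinguishes the three cases: $\eta(T_1,T_2)=1$ if and only if $T_1\cap T_2$ is a union of two photons which intersect in exactly one point; $\eta(T_1,T_2)>1$ if and only if $T_1\cap T_2$ is a spacelike circle; $\eta(T_1,T_2)<1$ if and only if $T_1\cap T_2$ is a timelike circle.
   Context: Let $W$ be a $5$-dimensional real vector space with a symmetric bilinear form $\cdot$ of signature $(3,2)$ (three positive, two negative directions). For a linear subspace $U\subset W$ let $\mathcal N(U)=\{v\in U: v\cdot v=0\}$, and let $\mathbb P(\mathcal N(U))$ be the set of points $[v]$ of $\mathbb P(W)$ with $0\ne v\in\mathcal N(U)$. The Einstein universe is $\mathsf{Ein}^3=\mathbb P(\mathcal N(W))$, a smooth $3$-manifold. A photon is $\mathbb P(P)$ for a totally isotropic $2$-plane $P\subset W$. A spacelike circle (resp. timelike circle) is $\mathbb P(\mathcal N(U))$ where $U\subset W$ is a $3$-dimensional subspace on which the form has signature $(2,1)$ (resp. $(1,2)$). An Einstein torus is $\mathbb P(\mathcal N(s^\perp))$ where $s\in W$ is a spacelike vector, i.e. $s\cdot s>0$; one may normalize $s\cdot s=1$, and then $s$ is determined by the torus up to sign.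 If $T_1,T_2$ are the Einstein tori defined by unit spacelike vectors $s_1,s_2$ ($s_i\cdot s_i=1$), define $\eta(T_1,T_2)=|s_1\cdot s_2|$. Transversality refers to transversality of the smooth surfaces $T_1,T_2$ in $\mathsf{Ein}^3$. *)

theory Defs
  imports "HOL-Analysis.Analysis"
begin

definition symmetric_bilinear :: "('w::real_vector \<Rightarrow> 'w \<Rightarrow> real) \<Rightarrow> bool" where
  "symmetric_bilinear B \<longleftrightarrow> bilinear B \<and> (\<forall>x y. B x y = B y x)"

text \<open>The restriction of \<open>B\<close> to \<open>U\<close> is nondegenerate with \<open>p\<close> positive and \<open>q\<close> negative
  directions: some orthogonal basis of \<open>U\<close> has \<open>p\<close> positive, \<open>q\<close> negative and no null vectors
  (by Sylvester's law, \<open>p\<close> and \<open>q\<close> do not depend on the basis).\<close>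

definition has_signature ::
    "('w::real_vector \<Rightarrow> 'w \<Rightarrow> real) \<Rightarrow> 'w set \<Rightarrow> nat \<Rightarrow> nat \<Rightarrow> bool" where
  "has_signature B U p q \<longleftrightarrow>
    (\<exists>E. finite E \<and> independent E \<and> span E = U \<and>
         (\<forall>x\<in>E. \<forall>y\<in>E. x \<noteq> y \<longrightarrow> B x y = 0) \<and>
         card {e\<in>E. B e e > 0} = p \<and> card {e\<in>E. B e e < 0} = q \<and> card E = p + q)"

text \<open>Points of the projective space of \<open>W\<close> are the lines \<open>span {v}\<close> with \<open>v \<noteq> 0\<close>.\<close>

definition proj_set :: "'w::real_vector set \<Rightarrow> 'w set set" where
  "proj_set A = {span {v} | v. v \<in> A \<and> v \<noteq> 0}"

definition null_vectors :: "('w::real_vector \<Rightarrow> 'w \<Rightarrow> real) \<Rightarrow> 'w set \<Rightarrow> 'w set" where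
  "null_vectors B U = {v \<in> U. B v v = 0}"

definition orth_compl :: "('w::real_vector \<Rightarrow> 'w \<Rightarrow> real) \<Rightarrow> 'w \<Rightarrow> 'w set" where
  "orth_compl B s = {v. B s v = 0}"

definition Ein :: "('w::real_vector \<Rightarrow> 'w \<Rightarrow> real) \<Rightarrow> 'w set set" where
  "Ein B = proj_set (null_vectors B UNIV)"

definition photon :: "('w::real_vector \<Rightarrow> 'w \<Rightarrow> real) \<Rightarrow> 'w set set \<Rightarrow> bool" where
  "photon B X \<longleftrightarrow>
    (\<exists>P. subspace P \<and> dim P = 2 \<and> (\<forall>x\<in>P. \<forall>y\<in>P. B x y = 0) \<and> X = proj_set P)"

definition spacelike_circle :: "('w::real_vector \<Rightarrow> 'w \<Rightarrow> real) \<Rightarrow> 'w set set \<Rightarrow> bool" where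
  "spacelike_circle B X \<longleftrightarrow>
    (\<exists>U. subspace U \<and> dim U = 3 \<and> has_signature B U 2 1 \<and> X = proj_set (null_vectors B U))"

definition timelike_circle :: "('w::real_vector \<Rightarrow> 'w \<Rightarrow> real) \<Rightarrow> 'w set set \<Rightarrow> bool" where
  "timelike_circle B X \<longleftrightarrow>
    (\<exists>U. subspace U \<and> dim U = 3 \<and> has_signature B U 1 2 \<and> X = proj_set (null_vectors B U))"

definition torus_of :: "('w::real_vector \<Rightarrow> 'w \<Rightarrow> real) \<Rightarrow> 'w \<Rightarrow> 'w set set" where
  "torus_of B s = proj_set (null_vectors B (orth_compl B s))"

definition einstein_torus :: "('w::real_vector \<Rightarrow> 'w \<Rightarrow> real) \<Rightarrow> 'w set set \<Rightarrow> bool" where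
  "einstein_torus B T \<longleftrightarrow> (\<exists>s. B s s > 0 \<and> T = torus_of B s)"

text \<open>The description is proper for Einstein tori when \<open>B\<close> has signature \<open>(3,2)\<close>: the unit
  vector defining a torus is then unique up to sign.\<close>

definition eta ::
    "('w::real_vector \<Rightarrow> 'w \<Rightarrow> real) \<Rightarrow> 'w set set \<Rightarrow> 'w set set \<Rightarrow> real" where
  "eta B T1 T2 =
    (THE r. \<exists>s1 s2. B s1 s1 = 1 \<and> B s2 s2 = 1 \<and>
                    T1 = torus_of B s1 \<and> T2 = torus_of B s2 \<and> r = \<bar>B s1 s2\<bar>)"

definition two_photons_meeting_once ::
    "('w::real_vector \<Rightarrow> 'w \<Rightarrow> real) \<Rightarrow> 'w set set \<Rightarrow> bool" where
  "two_photons_meeting_once B X \<longleftrightarrow>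
    (\<exists>F G. photon B F \<and> photon B G \<and> X = F \<union> G \<and> (\<exists>p. F \<inter> G = {p}))"

text \<open>Infinitely differentiable on an open set \<open>I\<close>; \<open>D n\<close> is the \<open>n\<close>-th derivative.\<close>

definition smooth_curve_on :: "real set \<Rightarrow> (real \<Rightarrow> 'w::real_normed_vector) \<Rightarrow> bool" where
  "smooth_curve_on I c \<longleftrightarrow>
    (\<exists>D. D 0 = c \<and> (\<forall>n. \<forall>t\<in>I. (D n has_vector_derivative D (Suc n) t) (at t)))"

text \<open>For a submanifold \<open>X\<close> of the projective space and \<open>v \<noteq> 0\<close>, this is the preimage of the
  tangent space of \<open>X\<close> at \<open>[v]\<close> under the differential at \<open>v\<close> of the projection
  \<open>W - {0} \<rightarrow> P(W)\<close>: every smooth curve in \<open>X\<close> through \<open>[v]\<close> lifts locally to a smooth curve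
  through \<open>v\<close>, and tangent vectors are the velocities of such curves. The differential is onto
  with kernel \<open>span {v}\<close>, so that the tangent space of \<open>X\<close> at \<open>[v]\<close> is this set modulo
  \<open>span {v}\<close>.\<close>

definition lifted_tangent_space :: "'w::real_normed_vector set set \<Rightarrow> 'w \<Rightarrow> 'w set" where
  "lifted_tangent_space X v =
    {w. \<exists>c e. e > 0 \<and> smooth_curve_on {-e<..<e} c \<and> c 0 = v \<and>
              (\<forall>t\<in>{-e<..<e}. c t \<noteq> 0 \<and> span {c t} \<in> X) \<and>
              (c has_vector_derivative w) (at 0)}"

text \<open>The tangent spaces of \<open>X\<close> and \<open>Y\<close> together span that of \<open>M\<close> at every common point. All
  lifted tangent spaces contain \<open>span {v}\<close>, so this may be tested before passing to the
  quotient by \<open>span {v}\<close>.\<close>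

definition transverse_in ::
    "'w::real_normed_vector set set \<Rightarrow> 'w set set \<Rightarrow> 'w set set \<Rightarrow> bool" where
  "transverse_in M X Y \<longleftrightarrow>
    (\<forall>v. v \<noteq> 0 \<and> span {v} \<in> X \<inter> Y \<longrightarrow>
      {x + y | x y. x \<in> lifted_tangent_space X v \<and> y \<in> lifted_tangent_space Y v}
        = lifted_tangent_space M v)"

end

theory Submission imports Defs begin

text \<open>Write the tori as \<open>s\<^sub>i\<^sup>\<bottom>\<close> with \<open>s\<^sub>i\<close> unit, \<open>a = s\<^sub>1 \<cdot> s\<^sub>2\<close> and \<open>w = s\<^sub>2 - a s\<^sub>1\<close>. Then \<open>T\<^sub>1 \<inter> T\<^sub>2\<close>
  is the projectivised null cone of \<open>U = s\<^sub>1\<^sup>\<bottom> \<inter> w\<^sup>\<bottom>\<close>, where \<open>s\<^sub>1\<^sup>\<bottom>\<close> has signature \<open>(2,2)\<close> and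
  \<open>w \<cdot> w = 1 - a\<^sup>2\<close>. If \<open>w\<close> is not null, \<open>U\<close> has signature \<open>(2,1)\<close> or \<open>(1,2)\<close> according to the
  sign of \<open>1 - a\<^sup>2\<close>, and \<open>w\<close> itself is a tangent direction of \<open>T\<^sub>1\<close> that is not tangent to \<open>T\<^sub>2\<close>.
  If \<open>w\<close> is null, \<open>U/w\<close> is a hyperbolic plane, whose two null lines give the two photons.
  The three cases exclude each other because the null vectors of an indefinite nondegenerate
  subspace span it, and because isotropic subspaces of a circle's \<open>U\<close> are lines.\<close>

definition nondegenerate_on :: "('w::real_vector \<Rightarrow> 'w \<Rightarrow> real) \<Rightarrow> 'w set \<Rightarrow> bool" where
  "nondegenerate_on B U \<longleftrightarrow> (\<forall>x\<in>U. (\<forall>y\<in>U. B x y = 0) \<longrightarrow> x = 0)"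

subsection \<open>Lines of a cone and smooth curves\<close>

lemma span_mem_proj_set_iff:
  fixes v :: "'w::real_vector"
  assumes cone: "\<And>c x. x \<in> A \<Longrightarrow> c *\<^sub>R x \<in> A" and "v \<noteq> 0"
  shows "span {v} \<in> proj_set A \<longleftrightarrow> v \<in> A"
proof
  assume "span {v} \<in> proj_set A"
  then obtain x where x: "x \<in> A" "span {v} = span {x}" by (auto simp: proj_set_def)
  then have "v \<in> span {x}" using span_base by blast
  then show "v \<in> A" using cone[OF x(1)] by (auto simp: span_singleton)
qed (use assms in \<open>auto simp: proj_set_def\<close>)

lemma proj_set_Int:
  assumes "\<And>c x. x \<in> A \<Longrightarrow> c *\<^sub>R x \<in> A" "\<And>c x. x \<in> C \<Longrightarrow> c *\<^sub>R x \<in> C"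
  shows "proj_set A \<inter> proj_set C = proj_set (A \<inter> C)"
proof
  show "proj_set A \<inter> proj_set C \<subseteq> proj_set (A \<inter> C)"
  proof
    fix L assume L: "L \<in> proj_set A \<inter> proj_set C"
    then obtain v where v: "v \<in> A" "v \<noteq> 0" "L = span {v}" by (auto simp: proj_set_def)
    then have "v \<in> C" using L span_mem_proj_set_iff[OF assms(2)] by auto
    then show "L \<in> proj_set (A \<inter> C)" using v by (auto simp: proj_set_def)
  qed
qed (auto simp: proj_set_def)

lemma proj_set_Un: "proj_set (A \<union> C) = proj_set A \<union> proj_set C"
  by (auto simp: proj_set_def)

lemma proj_set_span_singleton:
  assumes "w \<noteq> 0"
  shows "proj_set (span {w}) = {span {w}}"
proof
  show "proj_set (span {w}) \<subseteq> {span {w}}"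
  proof
    fix L assume "L \<in> proj_set (span {w})"
    then obtain k where k: "k *\<^sub>R w \<noteq> 0" "L = span {k *\<^sub>R w}"
      by (auto simp: proj_set_def span_singleton)
    then have "w = (1 / k) *\<^sub>R (k *\<^sub>R w)" by simp
    then have "w \<in> span {k *\<^sub>R w}" by (metis singletonI span_base span_scale)
    moreover have "k *\<^sub>R w \<in> span {w}" by (simp add: span_base span_scale)
    ultimately show "L \<in> {span {w}}"
      unfolding k(2) by (auto simp: span_eq)
  qed
  show "{span {w}} \<subseteq> proj_set (span {w})"
    using assms by (auto simp: proj_set_def intro: span_base)
qed

text \<open>All tangent vectors constructed below are velocities of cubic curves, so smoothness of
  these suffices. The \<open>D\<close> in the proof lists the derivatives, which vanish from order 4
  on.\<close>

lemma smooth_curve_cubic: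
  fixes a b c d :: "'w::real_normed_vector"
  shows "smooth_curve_on I (\<lambda>t. a + t *\<^sub>R b + t\<^sup>2 *\<^sub>R c + t ^ 3 *\<^sub>R d)"
proof -
  define D where "D n t = (if n = 0 then a + t *\<^sub>R b + t\<^sup>2 *\<^sub>R c + t ^ 3 *\<^sub>R d
    else if n = 1 then b + (2 * t) *\<^sub>R c + (3 * t\<^sup>2) *\<^sub>R d
    else if n = 2 then 2 *\<^sub>R c + (6 * t) *\<^sub>R d
    else if n = 3 then 6 *\<^sub>R d else 0)" for n :: nat and t :: real
  have "D 0 = (\<lambda>t. a + t *\<^sub>R b + t\<^sup>2 *\<^sub>R c + t ^ 3 *\<^sub>R d)" by (simp add: D_def fun_eq_iff)
  moreover have "(D n has_vector_derivative D (Suc n) t) (at t)" for n t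
  proof -
    consider "n = 0" | "n = 1" | "n = 2" | "n = 3" | "n > 3" by linarith
    then show ?thesis
    proof cases
      case 1
      then show ?thesis unfolding D_def
        by (auto intro!: derivative_eq_intros simp: power2_eq_square)
    next
      case 2
      then show ?thesis unfolding D_def
        by (auto intro!: derivative_eq_intros)
    next
      case 3
      then show ?thesis unfolding D_def
        by (auto intro!: derivative_eq_intros)
    qed (simp_all add: D_def[abs_def])
  qed
  ultimately show ?thesis unfolding smooth_curve_on_def by blast
qed

subsection \<open>Signature and Sylvester's law of inertia\<close>

locale symmetric_form =
  fixes B :: "'w::euclidean_space \<Rightarrow> 'w \<Rightarrow> real"
  assumes symmetric_bilinear: "symmetric_bilinear B"
begin

lemma bilinear: "bilinear B"
  using symmetric_bilinear by (simp add: symmetric_bilinear_def)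

lemma commute: "B x y = B y x"
  using symmetric_bilinear by (simp add: symmetric_bilinear_def)

lemmas form_simps =
  bilinear_ladd[OF bilinear] bilinear_radd[OF bilinear]
  bilinear_lsub[OF bilinear] bilinear_rsub[OF bilinear]
  bilinear_lmul[OF bilinear] bilinear_rmul[OF bilinear]
  bilinear_lneg[OF bilinear] bilinear_rneg[OF bilinear]
  bilinear_lzero[OF bilinear] bilinear_rzero[OF bilinear]

lemma sum_left: "B (sum f A) y = (\<Sum>i\<in>A. B (f i) y)"
  using linear_sum[of "\<lambda>x. B x y" f A] bilinear by (simp add: bilinear_def)

text \<open>Negating the form exchanges positive and negative directions, so each result about
  positive vectors yields its negative counterpart by instantiating the locale with
  \<open>- B\<close>.\<close>

lemma uminus_form: "symmetric_form (\<lambda>x y. - B x y)"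
proof unfold_locales
  have "linear (\<lambda>y. - B x y)" "linear (\<lambda>x. - B x y)" for x y
    using bilinear by (auto simp: bilinear_def intro: linear_compose_neg)
  then show "symmetric_bilinear (\<lambda>x y. - B x y)"
    using commute by (auto simp: symmetric_bilinear_def bilinear_def)
qed

lemma subspace_orth_compl: "subspace (orth_compl B v)"
  by (auto simp: subspace_def orth_compl_def form_simps)

lemma has_signature_uminus:
  "has_signature (\<lambda>x y. - B x y) U q p \<longleftrightarrow> has_signature B U p q"
  unfolding has_signature_def by (auto simp: add.commute)

lemma orth_compl_uminus: "orth_compl (\<lambda>x y. - B x y) v = orth_compl B v"
  by (simp add: orth_compl_def)

lemma orthogonal_sum:
  assumes "finite E" "\<forall>x\<in>E. \<forall>y\<in>E. x \<noteq> y \<longrightarrow> B x y = 0" "e \<in> E"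
  shows "B (\<Sum>x\<in>E. c x *\<^sub>R x) e = c e * B e e"
proof -
  have "B (\<Sum>x\<in>E. c x *\<^sub>R x) e = (\<Sum>x\<in>E. if x = e then c e * B e e else 0)"
    unfolding sum_left using assms by (intro sum.cong) (auto simp: form_simps)
  then show ?thesis using assms by simp
qed

text \<open>The positive and the negative basis vectors already number
  \<open>p + q = card E\<close>, which leaves no room for null ones.\<close>

lemma signature_nonnull_basis:
  assumes "has_signature B U p q"
  obtains E where "finite E" "independent E" "span E = U"
    "\<forall>x\<in>E. \<forall>y\<in>E. x \<noteq> y \<longrightarrow> B x y = 0" "\<forall>e\<in>E. B e e \<noteq> 0"
    "card {e\<in>E. B e e > 0} = p" "card {e\<in>E. B e e < 0} = q" "card E = p + q"
proof -
  obtain E where E: "finite E" "independent E" "span E = U"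
    "\<forall>x\<in>E. \<forall>y\<in>E. x \<noteq> y \<longrightarrow> B x y = 0"
    "card {e\<in>E. B e e > 0} = p" "card {e\<in>E. B e e < 0} = q" "card E = p + q"
    using assms unfolding has_signature_def by blast
  have "{e\<in>E. B e e > 0} \<union> {e\<in>E. B e e < 0} = E"
  proof (rule card_subset_eq)
    show "card ({e\<in>E. B e e > 0} \<union> {e\<in>E. B e e < 0}) = card E"
      using E by (subst card_Un_disjoint) auto
  qed (use E in auto)
  then have "\<forall>e\<in>E. B e e \<noteq> 0" by (metis (no_types, lifting) UnE less_irrefl mem_Collect_eq)
  with E that show ?thesis by blast
qed

lemma signature_imp_subspace: "has_signature B U p q \<Longrightarrow> subspace U"
  unfolding has_signature_def by (auto simp: subspace_span)

lemma signature_imp_dim: "has_signature B U p q \<Longrightarrow> dim U = p + q"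
  unfolding has_signature_def by (metis dim_span_eq_card_independent)

text \<open>Pairing with a basis vector \<open>e\<close> gives the coefficient of \<open>e\<close>
  times the nonzero number \<open>B e e\<close>.\<close>

lemma signature_imp_nondegenerate:
  assumes "has_signature B U p q"
  shows "nondegenerate_on B U"
  unfolding nondegenerate_on_def
proof (intro ballI impI)
  fix x assume x: "x \<in> U" "\<forall>y\<in>U. B x y = 0"
  obtain E where E: "finite E" "span E = U" "\<forall>x\<in>E. \<forall>y\<in>E. x \<noteq> y \<longrightarrow> B x y = 0" "\<forall>e\<in>E. B e e \<noteq> 0"
    by (rule signature_nonnull_basis[OF assms]) blast
  obtain c where c: "x = (\<Sum>e\<in>E. c e *\<^sub>R e)"
    using x(1) E by (auto simp: span_finite)
  have "c e = 0" if "e \<in> E" for e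
    using orthogonal_sum[of E e c] that E x(2) span_base[of e E] by (auto simp: c)
  then show "x = 0" by (simp add: c)
qed

lemma positive_definite_subspace:
  assumes sig: "has_signature B U p q"
  obtains P where "subspace P" "P \<subseteq> U" "dim P = p" "\<And>x. x \<in> P \<Longrightarrow> x \<noteq> 0 \<Longrightarrow> B x x > 0"
proof -
  obtain E where E: "finite E" "independent E" "span E = U" "\<forall>x\<in>E. \<forall>y\<in>E. x \<noteq> y \<longrightarrow> B x y = 0"
    "card {e\<in>E. B e e > 0} = p"
    by (rule signature_nonnull_basis[OF sig]) blast
  define F where "F = {e\<in>E. B e e > 0}"
  have F: "finite F" "independent F" "\<forall>x\<in>F. \<forall>y\<in>F. x \<noteq> y \<longrightarrow> B x y = 0" "F \<subseteq> E" "card F = p"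
    using E independent_mono[of E F] by (auto simp: F_def)
  have pos: "B x x > 0" if x: "x \<in> span F" "x \<noteq> 0" for x
  proof -
    obtain c where c: "x = (\<Sum>e\<in>F. c e *\<^sub>R e)"
      using x(1) F(1) by (auto simp: span_finite)
    have "B x x = (\<Sum>e\<in>F. c e * B e x)"
      by (subst (1) c) (simp add: sum_left form_simps)
    also have "\<dots> = (\<Sum>e\<in>F. (c e)\<^sup>2 * B e e)"
      using orthogonal_sum[OF F(1,3), of _ c] commute
      by (intro sum.cong) (auto simp: c power2_eq_square)
    also have "\<dots> > 0"
    proof -
      obtain e where "e \<in> F" "c e \<noteq> 0"
        using x(2) unfolding c by (metis (no_types, lifting) scale_eq_0_iff sum.neutral)
      then show ?thesis
        using F(1) by (intro sum_pos2[of F e]) (auto simp: F_def)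
    qed
    finally show ?thesis .
  qed
  show ?thesis
    using that[of "span F"] pos F span_mono[OF F(4)] E(3) dim_span_eq_card_independent[OF F(2)]
    by (metis subspace_span)
qed

text \<open>\<open>P\<close> meets a positive definite subspace of dimension \<open>p\<close> only
  in 0, and the sum of the two still fits into dimension \<open>p + q\<close>. This bound gives the
  law of inertia and also limits isotropic subspaces.\<close>

lemma nonpositive_dim_le:
  assumes sig: "has_signature B U p q" and P: "subspace P" "P \<subseteq> U" "\<And>v. v \<in> P \<Longrightarrow> B v v \<le> 0"
  shows "dim P \<le> q"
proof -
  obtain F where F: "subspace F" "F \<subseteq> U" "dim F = p" "\<And>x. x \<in> F \<Longrightarrow> x \<noteq> 0 \<Longrightarrow> B x x > 0"
    using positive_definite_subspace[OF sig] by blast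
  have "P \<inter> F \<subseteq> {0}" using P(3) F(4) by force
  then have "dim (P \<inter> F) = 0" by simp
  then have "dim {x + y |x y. x \<in> P \<and> y \<in> F} = dim P + p"
    using dim_sums_Int[of P F] P F by linarith
  moreover have "{x + y |x y. x \<in> P \<and> y \<in> F} \<subseteq> U"
    using P(2) F(2) signature_imp_subspace[OF sig] by (auto intro!: subspace_add[of U])
  then have "dim {x + y |x y. x \<in> P \<and> y \<in> F} \<le> dim U"
    by (rule dim_subset)
  ultimately show ?thesis using signature_imp_dim[OF sig] by simp
qed

lemma nonnegative_dim_le:
  assumes "has_signature B U p q" "subspace P" "P \<subseteq> U" "\<And>v. v \<in> P \<Longrightarrow> B v v \<ge> 0"
  shows "dim P \<le> p"
  using symmetric_form.nonpositive_dim_le[OF uminus_form, of U q p P] assms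
  by (simp add: has_signature_uminus)

lemma signature_positive_le:
  assumes "has_signature B U p q" "has_signature B U p' q'"
  shows "p' \<le> p"
proof -
  obtain F where F: "subspace F" "F \<subseteq> U" "dim F = p'" "\<And>x. x \<in> F \<Longrightarrow> x \<noteq> 0 \<Longrightarrow> B x x > 0"
    using positive_definite_subspace[OF assms(2)] by blast
  have "B x x \<ge> 0" if "x \<in> F" for x
    using F(4)[OF that] by (cases "x = 0") (auto simp: form_simps)
  then show ?thesis using nonnegative_dim_le[OF assms(1) F(1,2)] F(3) by simp
qed

text \<open>Sylvester's law: the positive indices bound each other, and the dimension then fixes the
  negative ones.\<close>

lemma signature_unique:
  assumes "has_signature B U p q" "has_signature B U p' q'"
  shows "p = p' \<and> q = q'"
  using signature_positive_le[OF assms] signature_positive_le[OF assms(2,1)]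
    signature_imp_dim[OF assms(1)] signature_imp_dim[OF assms(2)] by simp

section \<open>Splitting off a non-null vector\<close>

lemma signature_insert_positive:
  assumes U: "subspace U" "v \<in> U" "B v v > 0"
    and sig: "has_signature B (U \<inter> orth_compl B v) p q"
  shows "has_signature B U (Suc p) q"
proof -
  obtain E where E: "finite E" "independent E" "span E = U \<inter> orth_compl B v"
    "\<forall>x\<in>E. \<forall>y\<in>E. x \<noteq> y \<longrightarrow> B x y = 0"
    "card {e\<in>E. B e e > 0} = p" "card {e\<in>E. B e e < 0} = q" "card E = p + q"
    by (rule signature_nonnull_basis[OF sig]) blast
  have vE: "v \<notin> span E" using E U by (auto simp: orth_compl_def)
  then have "v \<notin> E" using span_base by blast
  have EU: "e \<in> U \<and> B v e = 0" if "e \<in> E" for e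
    using that E(3) span_base[of e E] by (auto simp: orth_compl_def)
  have "span (insert v E) = U"
  proof
    show "span (insert v E) \<subseteq> U" using EU U by (intro span_minimal) auto
    show "U \<subseteq> span (insert v E)"
    proof
      fix x assume "x \<in> U"
      then have "x - (B v x / B v v) *\<^sub>R v \<in> span E"
        using U by (auto simp: E(3) orth_compl_def form_simps subspace_diff subspace_scale)
      then show "x \<in> span (insert v E)" by (auto simp: span_breakdown_eq)
    qed
  qed
  moreover have "{e \<in> insert v E. B e e > 0} = insert v {e\<in>E. B e e > 0}"
    "{e \<in> insert v E. B e e < 0} = {e\<in>E. B e e < 0}"
    using U by auto
  moreover have "independent (insert v E)"
    using vE E(2) by (simp add: independent_insert)
  ultimately show ?thesis
    unfolding has_signature_def using E EU \<open>v \<notin> E\<close> commute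
    by (intro exI[of _ "insert v E"]) auto
qed

lemma signature_insert_negative:
  assumes "subspace U" "v \<in> U" "B v v < 0"
    and "has_signature B (U \<inter> orth_compl B v) p q"
  shows "has_signature B U p (Suc q)"
  using symmetric_form.signature_insert_positive[OF uminus_form, of U v q p] assms
  by (simp add: has_signature_uminus orth_compl_uminus)

text \<open>Every \<open>y\<close> in \<open>U\<close> is a multiple of \<open>v\<close> plus a
  vector of \<open>U\<close> orthogonal to \<open>v\<close>. Hence a vector orthogonal to
  \<open>v\<close> and to the complement is orthogonal to all of \<open>U\<close>.\<close>

lemma nondegenerate_orth_compl:
  assumes U: "subspace U" "v \<in> U" "B v v \<noteq> 0" and nd: "nondegenerate_on B U"
  shows "nondegenerate_on B (U \<inter> orth_compl B v)"
  unfolding nondegenerate_on_def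
proof (intro ballI impI)
  fix x assume x: "x \<in> U \<inter> orth_compl B v" "\<forall>y\<in>U \<inter> orth_compl B v. B x y = 0"
  have "B x y = 0" if "y \<in> U" for y
  proof -
    have "y - (B v y / B v v) *\<^sub>R v \<in> U \<inter> orth_compl B v"
      using U that by (auto simp: orth_compl_def form_simps subspace_diff subspace_scale)
    then have "B x (y - (B v y / B v v) *\<^sub>R v) = 0" using x by blast
    then show ?thesis using x commute[of x v] by (simp add: form_simps orth_compl_def)
  qed
  then show "x = 0" using nd x by (auto simp: nondegenerate_on_def)
qed

text \<open>Diagonalisation by induction on the dimension: split off a non-null vector and
  diagonalise its orthogonal complement.\<close>

lemma nondegenerate_imp_signature:
  assumes "subspace U" "nondegenerate_on B U"
  shows "\<exists>p q. has_signature B U p q"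
  using assms
proof (induction "dim U" arbitrary: U rule: less_induct)
  case less
  show ?case
  proof (cases "\<exists>v\<in>U. B v v \<noteq> 0")
    case True
    then obtain v where v: "v \<in> U" "B v v \<noteq> 0" by blast
    let ?V = "U \<inter> orth_compl B v"
    have V: "subspace ?V" using less.prems(1) subspace_orth_compl by (rule subspace_inter)
    have "v \<notin> ?V" using v by (simp add: orth_compl_def)
    then have "dim ?V < dim U"
      using v V less.prems(1) dim_psubset[of ?V U] by (auto simp: span_eq_iff[THEN iffD2])
    then obtain p q where "has_signature B ?V p q"
      using less.hyps V nondegenerate_orth_compl[OF less.prems(1) v less.prems(2)] by blast
    then show ?thesis
      using signature_insert_positive[OF less.prems(1) v(1)]
        signature_insert_negative[OF less.prems(1) v(1)] v(2)
      by (meson linorder_neqE_linordered_idom)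
  next
    case False
    \<comment> \<open>Polarisation: if all vectors of \<open>U\<close> are null, the form vanishes
      on \<open>U\<close>, and nondegeneracy leaves only 0.\<close>
    have "B x y = 0" if "x \<in> U" "y \<in> U" for x y
    proof -
      have "B (x + y) (x + y) = 0" "B x x = 0" "B y y = 0"
        using False that less.prems(1) by (auto simp: subspace_add)
      then show ?thesis using commute[of x y] by (simp add: form_simps)
    qed
    then have "U = {0}"
      using less.prems subspace_0 by (auto simp: nondegenerate_on_def)
    then have "has_signature B U 0 0"
      unfolding has_signature_def by (intro exI[of _ "{}"]) (auto simp: independent_empty)
    then show ?thesis by blast
  qed
qed

text \<open>The complement has some signature by diagonalisation. Adding \<open>v\<close> back gives
  a signature of \<open>U\<close>, and Sylvester's law identifies the numbers.\<close>

lemma signature_orth_compl_positive: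
  assumes sig: "has_signature B U (Suc p) q" and v: "v \<in> U" "B v v > 0"
  shows "has_signature B (U \<inter> orth_compl B v) p q"
proof -
  have U: "subspace U" using sig by (rule signature_imp_subspace)
  have "nondegenerate_on B (U \<inter> orth_compl B v)"
    using nondegenerate_orth_compl[OF U v(1)] v signature_imp_nondegenerate[OF sig] by simp
  then obtain p' q' where *: "has_signature B (U \<inter> orth_compl B v) p' q'"
    using nondegenerate_imp_signature U subspace_orth_compl by (meson subspace_inter)
  then have "has_signature B U (Suc p') q'"
    using signature_insert_positive[OF U v] by simp
  with sig * show ?thesis using signature_unique by blast
qed

lemma signature_orth_compl_negative:
  assumes "has_signature B U p (Suc q)" and "v \<in> U" "B v v < 0"
  shows "has_signature B (U \<inter> orth_compl B v) p q"
  using symmetric_form.signature_orth_compl_positive[OF uminus_form, of U q p v] assms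
  by (simp add: has_signature_uminus orth_compl_uminus)

lemma signature_witnesses:
  assumes "has_signature B U p q"
  shows "p > 0 \<Longrightarrow> \<exists>v\<in>U. B v v > 0" and "q > 0 \<Longrightarrow> \<exists>v\<in>U. B v v < 0"
proof -
  obtain E where E: "finite E" "span E = U" "card {e\<in>E. B e e > 0} = p" "card {e\<in>E. B e e < 0} = q"
    by (rule signature_nonnull_basis[OF assms]) blast
  show "\<exists>v\<in>U. B v v > 0" if "p > 0"
    using E that by (metis (no_types, lifting) card_gt_0_iff ex_in_conv mem_Collect_eq span_base)
  show "\<exists>v\<in>U. B v v < 0" if "q > 0"
    using E that by (metis (no_types, lifting) card_gt_0_iff ex_in_conv mem_Collect_eq span_base)
qed

subsection \<open>Null vectors\<close>

text \<open>As \<open>e\<close> and \<open>f\<close> are orthogonal with squares of opposite sign,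
  \<open>f\<close> can be rescaled by \<open>c\<close> so that \<open>e + c f\<close> and
  \<open>e - c f\<close> are both null; \<open>e\<close> is their mean.\<close>

lemma null_vectors_span_aux:
  assumes U: "subspace U" "e \<in> U" "f \<in> U" and ef: "B e f = 0" "B e e * B f f < 0"
  shows "e \<in> span (null_vectors B U)"
proof -
  define c where "c = sqrt (- B e e / B f f)"
  have "- B e e / B f f \<ge> 0" using ef(2)
    by (auto simp: divide_le_0_iff mult_less_0_iff)
  then have c: "c\<^sup>2 * B f f = - B e e" using ef(2) by (auto simp: c_def)
  have "e + c *\<^sub>R f \<in> null_vectors B U" "e - c *\<^sub>R f \<in> null_vectors B U"
    using U ef(1) c commute[of e f]
    by (auto simp: null_vectors_def form_simps subspace_add subspace_diff subspace_scale
        power2_eq_square algebra_simps)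
  then have "(1/2) *\<^sub>R ((e + c *\<^sub>R f) + (e - c *\<^sub>R f)) \<in> span (null_vectors B U)"
    by (meson span_add span_base span_scale)
  then show ?thesis by (simp add: scaleR_2[symmetric])
qed

text \<open>Each vector of an orthogonal basis can be paired with a basis vector of the opposite
  sign.\<close>

lemma span_null_vectors:
  assumes sig: "has_signature B U p q" and pq: "p > 0" "q > 0"
  shows "span (null_vectors B U) = U"
proof
  have U: "subspace U" using sig by (rule signature_imp_subspace)
  show "span (null_vectors B U) \<subseteq> U"
    using U by (intro span_minimal) (auto simp: null_vectors_def)
  obtain E where E: "finite E" "span E = U" "\<forall>x\<in>E. \<forall>y\<in>E. x \<noteq> y \<longrightarrow> B x y = 0" "\<forall>e\<in>E. B e e \<noteq> 0"
    "card {e\<in>E. B e e > 0} = p" "card {e\<in>E. B e e < 0} = q"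
    by (rule signature_nonnull_basis[OF sig]) blast
  obtain e0 f0 where ef: "e0 \<in> E" "B e0 e0 > 0" "f0 \<in> E" "B f0 f0 < 0"
    using E(5,6) pq
    by (metis (no_types, lifting) card_gt_0_iff ex_in_conv mem_Collect_eq)
  have "e \<in> span (null_vectors B U)" if e: "e \<in> E" for e
  proof (cases "B e e > 0")
    case True
    then show ?thesis using null_vectors_span_aux[OF U, of e f0] e ef E(2,3) span_base[of _ E]
      by (force simp: mult_pos_neg)
  next
    case False
    then have "B e e < 0" using E(4) e by force
    then show ?thesis using null_vectors_span_aux[OF U, of e e0] e ef E(2,3) span_base[of _ E]
      by (force simp: mult_neg_pos)
  qed
  then show "U \<subseteq> span (null_vectors B U)"
    using E(2) by (metis span_minimal subsetI subspace_span)
qed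

text \<open>Take \<open>y\<close> with \<open>B v y = 1\<close>. Subtracting a multiple of the null
  vector \<open>v\<close> keeps this pairing and can be tuned to make the square of \<open>y\<close>
  vanish.\<close>

lemma hyperbolic_partner:
  assumes U: "subspace U" "nondegenerate_on B U" and v: "v \<in> U" "v \<noteq> 0" "B v v = 0"
  obtains u where "u \<in> U" "B u u = 0" "B v u = 1"
proof -
  obtain x where x: "x \<in> U" "B v x \<noteq> 0" using U v by (auto simp: nondegenerate_on_def)
  define y where "y = (1 / B v x) *\<^sub>R x"
  have y: "y \<in> U" "B v y = 1" using x U by (auto simp: y_def form_simps subspace_scale)
  show ?thesis
  proof (rule that[of "y - (B y y / 2) *\<^sub>R v"])
    show "y - (B y y / 2) *\<^sub>R v \<in> U" using y v U by (simp add: subspace_diff subspace_scale)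
  qed (use y v commute[of y v] in \<open>auto simp: form_simps\<close>)
qed

lemma hyperbolic_plane_null_basis:
  assumes sig: "has_signature B U 1 1"
  obtains m n where "m \<in> U" "n \<in> U" "B m m = 0" "B n n = 0" "B m n \<noteq> 0" "U = span {m, n}"
proof -
  have U: "subspace U" using sig by (rule signature_imp_subspace)
  \<comment> \<open>The null vectors span the plane, so one of them is nonzero; its hyperbolic
    partner is the second basis vector.\<close>
  have "\<not> null_vectors B U \<subseteq> {0}"
  proof -
    have "dim (span (null_vectors B U)) = dim U" using span_null_vectors[OF sig] by simp
    then have "dim (null_vectors B U) = 2" using signature_imp_dim[OF sig] by simp
    then show ?thesis by (metis dim_eq_0 zero_neq_numeral)
  qed
  then obtain m where m: "m \<in> U" "B m m = 0" "m \<noteq> 0" by (auto simp: null_vectors_def)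
  obtain n where n: "n \<in> U" "B n n = 0" "B m n = 1"
    using hyperbolic_partner[OF U signature_imp_nondegenerate[OF sig] m(1,3,2)] by blast
  have mn: "m \<notin> span {n}" using m n by (auto simp: span_singleton form_simps)
  have n0: "n \<noteq> 0" using n by (auto simp: form_simps)
  then have ind: "independent {m, n}" "m \<noteq> n" using mn m
    by (auto simp: independent_insert intro: span_base)
  have "span {m, n} = U"
  proof (rule subspace_dim_equal)
    show "dim U \<le> dim (span {m, n})"
      using dim_span_eq_card_independent[OF ind(1)] ind(2) signature_imp_dim[OF sig] by simp
    show "span {m, n} \<subseteq> U" using m n U by (intro span_minimal) auto
  qed (use U in auto)
  then show ?thesis using that m n by (metis zero_neq_one)
qed

lemma null_vectors_scale:
  "subspace U \<Longrightarrow> x \<in> null_vectors B U \<Longrightarrow> c *\<^sub>R x \<in> null_vectors B U"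
  by (auto simp: null_vectors_def form_simps subspace_scale)

lemma span_mem_proj_null_iff:
  assumes "subspace U" "v \<noteq> 0"
  shows "span {v} \<in> proj_set (null_vectors B U) \<longleftrightarrow> v \<in> U \<and> B v v = 0"
  using span_mem_proj_set_iff[OF null_vectors_scale[OF assms(1)] assms(2)]
  by (simp add: null_vectors_def)

lemma proj_null_inject:
  assumes U: "subspace U" and V: "subspace V"
    and eq: "proj_set (null_vectors B U) = proj_set (null_vectors B V)"
  shows "null_vectors B U = null_vectors B V"
proof -
  have "v \<in> null_vectors B U \<longleftrightarrow> v \<in> null_vectors B V" for v
  proof (cases "v = 0")
    case True
    then show ?thesis using U V by (simp add: null_vectors_def subspace_0)
  next
    case False
    then show ?thesis
      using span_mem_proj_null_iff[OF U] span_mem_proj_null_iff[OF V] eq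
      by (simp add: null_vectors_def)
  qed
  then show ?thesis by blast
qed

text \<open>The null cone of an indefinite nondegenerate subspace spans it. This recovers the
  hyperplane of a torus and the 3-space of a circle from their point sets.\<close>

lemma signature_null_vectors_determine:
  assumes "has_signature B U p q" "has_signature B V p' q'" "p > 0" "q > 0" "p' > 0" "q' > 0"
    and "proj_set (null_vectors B U) = proj_set (null_vectors B V)"
  shows "U = V"
  using proj_null_inject[OF signature_imp_subspace signature_imp_subspace, OF assms(1,2,7)]
    span_null_vectors[OF assms(1,3,4)] span_null_vectors[OF assms(2,5,6)] by metis

lemma torus_Int_torus:
  "torus_of B s \<inter> torus_of B t = proj_set (null_vectors B (orth_compl B s \<inter> orth_compl B t))"
proof -
  have "null_vectors B (orth_compl B s) \<inter> null_vectors B (orth_compl B t)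
      = null_vectors B (orth_compl B s \<inter> orth_compl B t)"
    by (auto simp: null_vectors_def)
  then show ?thesis
    by (simp add: torus_of_def proj_set_Int null_vectors_scale subspace_orth_compl)
qed

subsection \<open>Tangent spaces\<close>

text \<open>The curve is the null curve \<open>v + t w' - (B w' w' / 2) t\<^sup>2 u\<close> multiplied by the factor
  \<open>1 + \<beta> t\<close>, which restores the component of \<open>w\<close> along \<open>v\<close>. The bound on \<open>t\<close> keeps \<open>B (c t) u = 1 + \<beta> t\<close> nonzero, so that \<open>c t \<noteq> 0\<close>.\<close>

lemma null_tangent:
  assumes U: "subspace U" "nondegenerate_on B U"
    and v: "v \<in> U" "v \<noteq> 0" "B v v = 0" and w: "w \<in> U" "B v w = 0"
  shows "w \<in> lifted_tangent_space (proj_set (null_vectors B U)) v"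
proof -
  obtain u where u: "u \<in> U" "B u u = 0" "B v u = 1"
    using hyperbolic_partner[OF U v] by blast
  define \<beta> where "\<beta> = B w u"
  define w' where "w' = w - \<beta> *\<^sub>R v"
  have w': "w' \<in> U" "B v w' = 0" "B w' u = 0"
    using U v w u by (auto simp: w'_def \<beta>_def form_simps subspace_diff subspace_scale)
  define \<gamma> where "\<gamma> = B w' w' / 2"
  define c where "c t = (1 + \<beta> * t) *\<^sub>R (v + t *\<^sub>R w' - (\<gamma> * t\<^sup>2) *\<^sub>R u)" for t :: real
  define e where "e = 1 / (\<bar>\<beta>\<bar> + 1)"
  have c_cubic: "c = (\<lambda>t. v + t *\<^sub>R w + t\<^sup>2 *\<^sub>R (\<beta> *\<^sub>R w' - \<gamma> *\<^sub>R u) + t ^ 3 *\<^sub>R (- (\<beta> * \<gamma>) *\<^sub>R u))"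
    by (rule ext) (simp add: c_def w'_def algebra_simps power2_eq_square power3_eq_cube)
  have cU: "c t \<in> U" for t
    using U v w' u by (auto simp: c_def intro!: subspace_scale subspace_add subspace_diff)
  \<comment> \<open>Among \<open>v\<close>, \<open>w'\<close> and \<open>u\<close> the only pairings
    that can be nonzero are \<open>B w' w'\<close> and \<open>B v u = 1\<close>, so up to the
    squared scalar factor \<open>B (c t) (c t)\<close> is
    \<open>t^2 * B w' w' - 2 * \<gamma> * t^2\<close>.\<close>
  have "B w' w' = 2 * \<gamma>" by (simp add: \<gamma>_def)
  then have c_null: "B (c t) (c t) = 0" for t
    using v w' u commute[of u v] commute[of w' v] commute[of u w']
    by (simp add: c_def form_simps power2_eq_square algebra_simps)
  have cu: "B (c t) u = 1 + \<beta> * t" for t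
    using u w' by (simp add: c_def form_simps)
  have nz: "c t \<noteq> 0" if "t \<in> {-e<..<e}" for t
  proof -
    have "\<bar>\<beta> * t\<bar> < 1"
    proof -
      have "\<bar>\<beta>\<bar> * \<bar>t\<bar> \<le> \<bar>\<beta>\<bar> * e" using that by (intro mult_left_mono) auto
      also have "\<dots> < 1" by (simp add: e_def)
      finally show ?thesis by (simp add: abs_mult)
    qed
    then have "B (c t) u \<noteq> 0" unfolding cu by linarith
    then show ?thesis by (auto simp: form_simps)
  qed
  have "(c has_vector_derivative w) (at 0)"
    unfolding c_cubic by (auto intro!: derivative_eq_intros)
  moreover have "smooth_curve_on {-e<..<e} c"
    unfolding c_cubic by (rule smooth_curve_cubic)
  moreover have "e > 0" "c 0 = v" by (auto simp: e_def c_def)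
  ultimately show ?thesis
    unfolding lifted_tangent_space_def
    using nz span_mem_proj_null_iff[OF U(1)] cU c_null by blast
qed

text \<open>Differentiate the identity \<open>B (c t) (c t) = 0\<close> at 0 for a lifted curve
  \<open>c\<close>.\<close>

lemma Ein_tangent_orthogonal:
  assumes "w \<in> lifted_tangent_space (Ein B) v"
  shows "B v w = 0"
proof -
  obtain c e where c: "e > 0" "c 0 = v" "\<forall>t\<in>{-e<..<e}. c t \<noteq> 0 \<and> span {c t} \<in> Ein B"
    "(c has_vector_derivative w) (at 0)"
    using assms unfolding lifted_tangent_space_def by blast
  have null: "B (c t) (c t) = 0" if "t \<in> {-e<..<e}" for t
  proof -
    have "c t \<noteq> 0" "span {c t} \<in> proj_set (null_vectors B UNIV)"
      using c(3) that by (simp_all add: Ein_def)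
    then show ?thesis using span_mem_proj_null_iff[OF subspace_UNIV] by blast
  qed
  have bb: "bounded_bilinear B" using bilinear by (simp add: bilinear_conv_bounded_bilinear)
  have "((\<lambda>t. B (c t) (c t)) has_vector_derivative B (c 0) w + B w (c 0)) (at 0)"
    by (rule bounded_bilinear.has_vector_derivative[OF bb c(4) c(4)])
  moreover have "((\<lambda>t. B (c t) (c t)) has_vector_derivative 0) (at 0)"
  proof (rule has_vector_derivative_transform_within_open)
    show "((\<lambda>t. 0) has_vector_derivative (0::real)) (at (0::real))" by simp
    show "open {-e<..<e}" "0 \<in> {-e<..<e}" using c(1) by auto
  qed (use null in auto)
  ultimately have "B (c 0) w + B w (c 0) = 0" by (rule vector_derivative_unique_at)
  then show ?thesis using c(2) commute[of w v] by simp
qed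

lemma lifted_tangent_space_mono: "X \<subseteq> Y \<Longrightarrow> lifted_tangent_space X v \<subseteq> lifted_tangent_space Y v"
  unfolding lifted_tangent_space_def by blast

lemma torus_subset_Ein: "torus_of B s \<subseteq> Ein B"
  by (auto simp: torus_of_def Ein_def proj_set_def null_vectors_def)

subsection \<open>Intersections of Einstein tori\<close>

text \<open>The isotropic plane lies in \<open>U\<close>, since each of its lines is a point of
  \<open>F\<close>. Its form is both nonpositive and nonnegative, so its dimension 2 is bounded by
  \<open>q\<close> and by \<open>p\<close>.\<close>

lemma isotropic_plane_signature:
  assumes sig: "has_signature B U p q" and F: "photon B F" "F \<subseteq> proj_set (null_vectors B U)"
  shows "p \<ge> 2 \<and> q \<ge> 2"
proof -
  have U: "subspace U" using sig by (rule signature_imp_subspace)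
  obtain P where P: "subspace P" "dim P = 2" "\<forall>x\<in>P. \<forall>y\<in>P. B x y = 0" "F = proj_set P"
    using F(1) unfolding photon_def by blast
  have "P \<subseteq> U"
  proof
    fix v assume v: "v \<in> P"
    show "v \<in> U"
    proof (cases "v = 0")
      case False
      then have "span {v} \<in> F" using v by (auto simp: P(4) proj_set_def)
      then show ?thesis using F(2) span_mem_proj_null_iff[OF U False] by blast
    qed (simp add: U subspace_0)
  qed
  then show ?thesis
    using nonpositive_dim_le[OF sig P(1)] nonnegative_dim_le[OF sig P(1)] P(2,3) by simp
qed

lemma two_photons_signature:
  assumes "has_signature B U p q" "two_photons_meeting_once B (proj_set (null_vectors B U))"
  shows "p \<ge> 2 \<and> q \<ge> 2"
proof -
  obtain F G where "photon B F" "proj_set (null_vectors B U) = F \<union> G"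
    using assms(2) unfolding two_photons_meeting_once_def by blast
  then show ?thesis using isotropic_plane_signature[OF assms(1)] by simp
qed

lemma spacelike_circle_not_two_photons:
  assumes "spacelike_circle B X"
  shows "\<not> two_photons_meeting_once B X"
proof -
  obtain U where "has_signature B U 2 1" "X = proj_set (null_vectors B U)"
    using assms unfolding spacelike_circle_def by blast
  then show ?thesis using two_photons_signature by fastforce
qed

lemma timelike_circle_not_two_photons:
  assumes "timelike_circle B X"
  shows "\<not> two_photons_meeting_once B X"
proof -
  obtain U where "has_signature B U 1 2" "X = proj_set (null_vectors B U)"
    using assms unfolding timelike_circle_def by blast
  then show ?thesis using two_photons_signature by fastforce
qed

text \<open>Both descriptions would come from the same subspace, which would then have two different
  signatures.\<close>

lemma spacelike_circle_not_timelike_circle: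
  assumes "spacelike_circle B X"
  shows "\<not> timelike_circle B X"
proof
  assume "timelike_circle B X"
  then obtain V where V: "has_signature B V 1 2" "X = proj_set (null_vectors B V)"
    unfolding timelike_circle_def by blast
  obtain U where U: "has_signature B U 2 1" "X = proj_set (null_vectors B U)"
    using assms unfolding spacelike_circle_def by blast
  have "U = V"
    using signature_null_vectors_determine[OF U(1) V(1)] U(2) V(2) by simp
  then show False using signature_unique[OF U(1)] V(1) by fastforce
qed

lemma indefinite_proj_null_nonempty:
  assumes sig: "has_signature B U p q" and "p > 0" "q > 0"
  shows "proj_set (null_vectors B U) \<noteq> {}"
proof
  assume "proj_set (null_vectors B U) = {}"
  then have "null_vectors B U \<subseteq> {0}" by (auto simp: proj_set_def)
  then have "span (null_vectors B U) \<subseteq> {0}" by (metis span_mono span_insert_0 span_empty)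
  then have "U \<subseteq> {0}" using span_null_vectors[OF assms] by simp
  moreover obtain v where "v \<in> U" "B v v > 0" using signature_witnesses(1)[OF sig] assms(2) by blast
  ultimately show False by (auto simp: form_simps)
qed

section \<open>Transversality of tori with non-null residual\<close>

lemma tori_transverse:
  assumes nd: "nondegenerate_on B UNIV" and s: "B s s = 1" and t: "B t t = 1"
    and st: "\<bar>B s t\<bar> \<noteq> 1"
  shows "transverse_in (Ein B) (torus_of B s) (torus_of B t)"
  unfolding transverse_in_def
proof (intro allI impI)
  fix v assume v: "v \<noteq> 0 \<and> span {v} \<in> torus_of B s \<inter> torus_of B t"
  then have v0: "v \<noteq> 0" and vn: "B v v = 0" and vs: "B s v = 0" and vt: "B t v = 0"
    using span_mem_proj_null_iff[OF subspace_orth_compl, of v]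
    by (auto simp: torus_of_def orth_compl_def)
  \<comment> \<open>The hyperplane orthogonal to \<open>r\<close> is itself nondegenerate, so
    \<open>null_tangent\<close> applies inside it.\<close>
  have tangent: "w \<in> lifted_tangent_space (torus_of B r) v"
    if "B r r = 1" "B r v = 0" "B r w = 0" "B v w = 0" for r w
    unfolding torus_of_def
    using nondegenerate_orth_compl[OF subspace_UNIV, of r] that nd v0 vn
    by (intro null_tangent subspace_orth_compl) (auto simp: orth_compl_def)
  have Ein: "lifted_tangent_space (Ein B) v = {w. B v w = 0}"
    using Ein_tangent_orthogonal null_tangent[OF subspace_UNIV nd _ v0 vn]
    by (auto simp: Ein_def)
  show "{x + y |x y. x \<in> lifted_tangent_space (torus_of B s) v
      \<and> y \<in> lifted_tangent_space (torus_of B t) v} = lifted_tangent_space (Ein B) v" (is "?L = ?R")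
  proof
    have "B v x = 0" if "x \<in> lifted_tangent_space (torus_of B r) v" for r x
      using that lifted_tangent_space_mono[OF torus_subset_Ein] Ein_tangent_orthogonal by blast
    then show "?L \<subseteq> ?R" unfolding Ein by (auto simp: form_simps)
    show "?R \<subseteq> ?L"
    proof
      fix w assume "w \<in> ?R"
      then have w: "B v w = 0" by (simp add: Ein)
      \<comment> \<open>The direction \<open>z\<close> is tangent to the first torus, and
        \<open>B t z = 1 - (B s t)^2\<close> is nonzero. A multiple of \<open>z\<close> can
        therefore absorb the \<open>t\<close>-component of \<open>w\<close>, leaving a vector
        tangent to the second torus.\<close>
      define z where "z = t - B s t *\<^sub>R s"
      have "(B s t)\<^sup>2 \<noteq> 1" using st by (simp add: abs_square_eq_1)
      then have tz: "B t z \<noteq> 0"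
        using t commute[of t s] by (simp add: z_def form_simps power2_eq_square)
      have sz: "B s z = 0" "B v z = 0"
        using s vs vt commute[of v] by (simp_all add: z_def form_simps)
      define x where "x = (B t w / B t z) *\<^sub>R z"
      have "x \<in> lifted_tangent_space (torus_of B s) v"
        using sz by (intro tangent s vs) (simp_all add: x_def form_simps)
      moreover have "w - x \<in> lifted_tangent_space (torus_of B t) v"
        using sz tz w by (intro tangent t vt) (simp_all add: x_def form_simps)
      moreover have "w = x + (w - x)" by simp
      ultimately show "w \<in> ?L" by blast
    qed
  qed
qed

section \<open>The degenerate case: two photons\<close>

lemma orth_compl_Int_residual:
  "orth_compl B s \<inter> orth_compl B t = orth_compl B s \<inter> orth_compl B (t - a *\<^sub>R s)"
  by (auto simp: orth_compl_def form_simps)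

text \<open>\<open>V\<close> is the orthogonal sum of the hyperbolic plane spanned by
  \<open>w\<close> and a null partner \<open>u\<close> and a second hyperbolic plane
  \<open>?H\<close>. The complement of \<open>w\<close> in \<open>V\<close> is \<open>?H\<close>
  plus the line of \<open>w\<close>, and its null vectors are governed by the two null lines of
  \<open>?H\<close>.\<close>

lemma degenerate_two_photons:
  assumes sig: "has_signature B V 2 2" and w: "w \<in> V" "w \<noteq> 0" "B w w = 0"
  shows "two_photons_meeting_once B (proj_set (null_vectors B (V \<inter> orth_compl B w)))"
proof -
  have V: "subspace V" using sig by (rule signature_imp_subspace)
  obtain u where u: "u \<in> V" "B u u = 0" "B w u = 1"
    using hyperbolic_partner[OF V signature_imp_nondegenerate[OF sig] w] by blast
  have uw: "B u w = 1" using u commute[of u w] by simp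
  \<comment> \<open>This is the complement of both \<open>w\<close> and \<open>u\<close>. It is
    written with \<open>w + u\<close> and \<open>w - u\<close>, of squares 2 and -2, because the
    signature lemmas remove only non-null vectors.\<close>
  let ?H = "V \<inter> orth_compl B (w + u) \<inter> orth_compl B (w - u)"
  have "w + u \<in> V" "B (w + u) (w + u) > 0"
    using u uw w V by (simp_all add: form_simps subspace_add)
  then have "has_signature B (V \<inter> orth_compl B (w + u)) 1 2"
    using signature_orth_compl_positive[of V 1 2 "w + u"] sig by (simp add: numeral_2_eq_2)
  moreover have "w - u \<in> V \<inter> orth_compl B (w + u)" "B (w - u) (w - u) < 0"
    using u uw w V by (simp_all add: form_simps subspace_diff orth_compl_def)
  ultimately have "has_signature B ?H 1 1"
    using signature_orth_compl_negative[of "V \<inter> orth_compl B (w + u)" 1 1 "w - u"]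
    by (simp add: numeral_2_eq_2)
  then obtain m n where mn: "m \<in> ?H" "n \<in> ?H" "B m m = 0" "B n n = 0" "B m n \<noteq> 0" "?H = span {m, n}"
    by (rule hyperbolic_plane_null_basis)
  have nm: "B n m = B m n" by (rule commute)
  have wH: "B w x = 0" "B u x = 0" "x \<in> V" if "x \<in> ?H" for x
    using that by (auto simp: orth_compl_def form_simps)
  have wmn: "B w m = 0" "B w n = 0" "B m w = 0" "B n w = 0"
    using wH mn(1,2) commute by auto
  define P where "P x = span {w, x}" for x
  have P_eq: "P x = {b *\<^sub>R x + a *\<^sub>R w |a b. True}" for x
    by (auto simp: P_def span_insert span_singleton diff_eq_eq)
  \<comment> \<open>The vector \<open>y\<close> certifies independence: it is orthogonal to
    \<open>w\<close> but not to \<open>x\<close>.\<close>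
  have photon: "photon B (proj_set (P x))" if "x \<in> V" "B x x = 0" "B w x = 0" "B x y \<noteq> 0" "B w y = 0" for x y
  proof -
    have "w \<noteq> x" using that by auto
    moreover have "independent {w, x}"
    proof -
      have "x \<notin> span {w}" using that by (auto simp: span_singleton form_simps)
      then have "independent {x, w}" using w(2) by (simp add: independent_insert)
      then show ?thesis by (simp add: insert_commute)
    qed
    ultimately have "dim (P x) = 2"
      using dim_span_eq_card_independent[of "{w, x}"] by (simp add: P_def)
    moreover have "B y z = 0" if "y \<in> P x" "z \<in> P x" for y z
      using that w \<open>B x x = 0\<close> \<open>B w x = 0\<close> commute[of x w] by (auto simp: P_eq form_simps)
    ultimately show ?thesis
      unfolding photon_def by (intro exI[of _ "P x"]) (auto simp: P_def subspace_span)
  qed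
  have "photon B (proj_set (P m))" "photon B (proj_set (P n))"
    using photon[of m n] photon[of n m] mn(3,4,5) nm wmn wH(3) mn(1,2) by auto
  moreover have "null_vectors B (V \<inter> orth_compl B w) = P m \<union> P n"
  proof
    show "P m \<union> P n \<subseteq> null_vectors B (V \<inter> orth_compl B w)"
      using w V mn(3,4) wmn wH(3)[OF mn(1)] wH(3)[OF mn(2)]
      by (auto simp: null_vectors_def P_eq orth_compl_def form_simps intro!: subspace_add subspace_scale)
    show "null_vectors B (V \<inter> orth_compl B w) \<subseteq> P m \<union> P n"
    proof
      fix v assume "v \<in> null_vectors B (V \<inter> orth_compl B w)"
      then have v: "v \<in> V" "B w v = 0" "B v v = 0" by (auto simp: null_vectors_def orth_compl_def)
      \<comment> \<open>Since \<open>B u w = 1\<close>, subtracting \<open>k\<close> times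
        \<open>w\<close> makes \<open>v\<close> orthogonal to \<open>u\<close> and so moves it into
        \<open>?H\<close>.\<close>
      define k where "k = B u v"
      have "v - k *\<^sub>R w \<in> ?H"
        using v w uw u V by (auto simp: k_def orth_compl_def form_simps subspace_diff subspace_scale)
      then obtain b c where "v - k *\<^sub>R w = b *\<^sub>R m + c *\<^sub>R n"
        unfolding mn(6) by (auto simp: span_insert span_singleton algebra_simps)
      then have vk: "v = k *\<^sub>R w + b *\<^sub>R m + c *\<^sub>R n" by (simp add: algebra_simps)
      \<comment> \<open>As \<open>w\<close> is null and orthogonal to \<open>m\<close> and
        \<open>n\<close>, \<open>B v v\<close> equals \<open>2 * b * c * B m n\<close>.\<close>
      have "b * c * B m n = 0"
        using v(3) w mn(3,4) wmn nm by (simp add: vk form_simps)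
      then have "b = 0 \<or> c = 0" using mn(5) by simp
      then have "v = b *\<^sub>R m + k *\<^sub>R w \<or> v = c *\<^sub>R n + k *\<^sub>R w"
        using vk by auto
      then show "v \<in> P m \<union> P n" unfolding P_eq by blast
    qed
  qed
  moreover have "P m \<inter> P n = span {w}"
  proof
    show "P m \<inter> P n \<subseteq> span {w}"
    proof
      fix v assume v: "v \<in> P m \<inter> P n"
      then obtain a b where ab: "v = b *\<^sub>R m + a *\<^sub>R w" by (auto simp: P_eq)
      \<comment> \<open>All of \<open>P n\<close> is orthogonal to \<open>n\<close>, whereas the
        expression of \<open>v\<close> in \<open>P m\<close> gives
        \<open>B v n = b * B m n\<close>.\<close>
      have "B v n = 0" using v mn(4) wmn by (auto simp: P_eq form_simps)
      then have "b = 0" using mn(5) wmn by (simp add: ab form_simps)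
      then show "v \<in> span {w}" by (simp add: ab span_base span_scale)
    qed
    show "span {w} \<subseteq> P m \<inter> P n" by (auto simp: P_def intro: span_mono[THEN subsetD])
  qed
  moreover have "proj_set (P m) \<inter> proj_set (P n) = proj_set (P m \<inter> P n)"
    by (intro proj_set_Int) (auto simp: P_def span_scale)
  ultimately show ?thesis
    unfolding two_photons_meeting_once_def
    by (intro exI[of _ "proj_set (P m)"] exI[of _ "proj_set (P n)"])
      (simp add: proj_set_Un proj_set_span_singleton[OF w(2)])
qed

section \<open>Unit normals and the invariant \<open>eta\<close>\<close>

text \<open>Equal tori have equal hyperplanes. The part of \<open>t\<close> orthogonal to
  \<open>s\<close> then lies in this nondegenerate hyperplane and is orthogonal to it, hence
  vanishes.\<close>

lemma torus_unit_unique: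
  assumes sig: "has_signature B UNIV 3 2" and s: "B s s = 1" and t: "B t t = 1"
    and eq: "torus_of B s = torus_of B t"
  shows "t = s \<or> t = - s"
proof -
  have sigO: "has_signature B (orth_compl B r) 2 2" if "B r r = 1" for r
    using signature_orth_compl_positive[of UNIV 2 2 r] sig that by (simp add: numeral_eq_Suc)
  have O: "orth_compl B s = orth_compl B t"
    using signature_null_vectors_determine[OF sigO[OF s] sigO[OF t]] eq by (simp add: torus_of_def)
  define z where "z = t - B s t *\<^sub>R s"
  have z: "z \<in> orth_compl B s" using s by (simp add: z_def orth_compl_def form_simps)
  have "B z y = 0" if "y \<in> orth_compl B s" for y
    using that O by (auto simp: z_def orth_compl_def form_simps)
  then have "z = 0"
    using signature_imp_nondegenerate[OF sigO[OF s]] z by (auto simp: nondegenerate_on_def)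
  then obtain k where k: "t = k *\<^sub>R s" by (simp add: z_def)
  then have "k * k = 1" using s t by (simp add: form_simps)
  then have "k = 1 \<or> k = -1" by (simp add: square_eq_1_iff)
  then show ?thesis using k by auto
qed

text \<open>The absolute value removes the sign ambiguity of the unit normals, so the definite
  description in \<open>eta\<close> has a unique solution.\<close>

lemma eta_torus_of:
  assumes sig: "has_signature B UNIV 3 2" and s: "B s s = 1" and t: "B t t = 1"
  shows "eta B (torus_of B s) (torus_of B t) = \<bar>B s t\<bar>"
  unfolding eta_def
proof (rule the_equality)
  fix r assume "\<exists>s1 s2. B s1 s1 = 1 \<and> B s2 s2 = 1 \<and> torus_of B s = torus_of B s1 \<and>
    torus_of B t = torus_of B s2 \<and> r = \<bar>B s1 s2\<bar>"
  then obtain s1 s2 where r: "B s1 s1 = 1" "B s2 s2 = 1" "torus_of B s = torus_of B s1"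
    "torus_of B t = torus_of B s2" "r = \<bar>B s1 s2\<bar>"
    by blast
  then have "s1 = s \<or> s1 = - s" "s2 = t \<or> s2 = - t"
    using torus_unit_unique[OF sig s] torus_unit_unique[OF sig t] by auto
  then show "r = \<bar>B s t\<bar>" using r(5) by (auto simp: form_simps)
qed (use s t in blast)

lemma einstein_torus_unit:
  assumes "einstein_torus B T"
  obtains s where "B s s = 1" "T = torus_of B s"
proof -
  obtain r where r: "B r r > 0" "T = torus_of B r" using assms unfolding einstein_torus_def by blast
  show ?thesis
  proof (rule that[of "(1 / sqrt (B r r)) *\<^sub>R r"])
    show "T = torus_of B ((1 / sqrt (B r r)) *\<^sub>R r)"
      using r by (simp add: torus_of_def orth_compl_def form_simps)
  qed (use r in \<open>simp add: form_simps\<close>)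
qed

end


section \<open>The three cases according to \<open>\<bar>B s t\<bar>\<close>\<close>

theorem theorem1:
  fixes B :: "'w::euclidean_space \<Rightarrow> 'w \<Rightarrow> real"
    and T1 T2 :: "'w set set"
  assumes "DIM('w) = 5"
    and "symmetric_bilinear B"
    and "has_signature B UNIV 3 2"
    and "einstein_torus B T1"
    and "einstein_torus B T2"
    and "T1 \<noteq> T2"
  shows "T1 \<inter> T2 \<noteq> {} \<and>
    (let c1 = two_photons_meeting_once B (T1 \<inter> T2);
         c2 = (spacelike_circle B (T1 \<inter> T2) \<and> transverse_in (Ein B) T1 T2);
         c3 = (timelike_circle B (T1 \<inter> T2) \<and> transverse_in (Ein B) T1 T2)
     in (c1 \<or> c2 \<or> c3) \<and> \<not> (c1 \<and> c2) \<and> \<not> (c1 \<and> c3) \<and> \<not> (c2 \<and> c3)) \<and>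
    (eta B T1 T2 = 1 \<longleftrightarrow> two_photons_meeting_once B (T1 \<inter> T2)) \<and>
    (eta B T1 T2 > 1 \<longleftrightarrow> spacelike_circle B (T1 \<inter> T2)) \<and>
    (eta B T1 T2 < 1 \<longleftrightarrow> timelike_circle B (T1 \<inter> T2))"
proof -
  interpret symmetric_form B by unfold_locales (rule assms(2))
  note sig = assms(3)
  obtain s where s: "B s s = 1" "T1 = torus_of B s" using assms(4) by (rule einstein_torus_unit)
  obtain t where t: "B t t = 1" "T2 = torus_of B t" using assms(5) by (rule einstein_torus_unit)
  define a where "a = B s t"
  define w where "w = t - a *\<^sub>R s"
  define V where "V = orth_compl B s"
  have sigV: "has_signature B V 2 2"
    using signature_orth_compl_positive[of UNIV 2 2 s] sig s by (simp add: numeral_eq_Suc V_def)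
  have T: "T1 \<inter> T2 = proj_set (null_vectors B (V \<inter> orth_compl B w))"
    unfolding s t V_def w_def by (simp add: torus_Int_torus orth_compl_Int_residual[of s t a])
  have wV: "w \<in> V" using s by (simp add: w_def V_def orth_compl_def form_simps a_def)
  have ww: "B w w = 1 - a\<^sup>2"
    using s t commute[of t s] by (simp add: w_def a_def form_simps power2_eq_square algebra_simps)
  have eta: "eta B T1 T2 = \<bar>a\<bar>" using eta_torus_of[OF sig s(1) t(1)] by (simp add: s t a_def)
  have transverse: "transverse_in (Ein B) T1 T2" if "\<bar>a\<bar> \<noteq> 1"
    unfolding s(2) t(2)
    using tori_transverse[OF signature_imp_nondegenerate[OF sig] s(1) t(1)] that by (simp add: a_def)
  have two: "two_photons_meeting_once B (T1 \<inter> T2)" if "\<bar>a\<bar> = 1"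
  proof -
    have "a\<^sup>2 = 1" using that by (simp add: abs_square_eq_1)
    \<comment> \<open>Otherwise \<open>t\<close> is a nonzero multiple of \<open>s\<close>, and the
      two tori coincide.\<close>
    moreover have "w \<noteq> 0"
    proof
      assume "w = 0"
      then have "t = a *\<^sub>R s" by (simp add: w_def)
      moreover have "a \<noteq> 0" using that by auto
      ultimately have "torus_of B t = torus_of B s"
        by (auto simp: torus_of_def orth_compl_def form_simps)
      then show False using assms(6) by (simp add: s t)
    qed
    ultimately show ?thesis unfolding T using degenerate_two_photons[OF sigV wV] ww by simp
  qed
  have space: "has_signature B (V \<inter> orth_compl B w) 2 1" if "\<bar>a\<bar> > 1"
  proof -
    \<comment> \<open>A timelike \<open>w\<close> takes one negative direction out of the signature
      (2,2) of \<open>V\<close>.\<close>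
    have "B w w < 0" using that unfolding ww by (auto simp: power2_gt_1_iff abs_if split: if_splits)
    then show ?thesis
      using signature_orth_compl_negative[of V 2 1 w] sigV wV by (simp add: numeral_2_eq_2)
  qed
  have time: "has_signature B (V \<inter> orth_compl B w) 1 2" if "\<bar>a\<bar> < 1"
  proof -
    have "B w w > 0" using that unfolding ww by (simp add: abs_square_less_1)
    then show ?thesis
      using signature_orth_compl_positive[of V 1 2 w] sigV wV by (simp add: numeral_2_eq_2)
  qed
  have spacelike: "spacelike_circle B (T1 \<inter> T2)" if "\<bar>a\<bar> > 1"
    unfolding spacelike_circle_def T
    using space[OF that] signature_imp_subspace[OF space[OF that]] signature_imp_dim[OF space[OF that]]
    by auto
  have timelike: "timelike_circle B (T1 \<inter> T2)" if "\<bar>a\<bar> < 1"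
    unfolding timelike_circle_def T
    using time[OF that] signature_imp_subspace[OF time[OF that]] signature_imp_dim[OF time[OF that]]
    by auto
  have nonempty: "T1 \<inter> T2 \<noteq> {}"
  proof (cases "\<bar>a\<bar>" "1 :: real" rule: linorder_cases)
    case less
    then show ?thesis unfolding T using indefinite_proj_null_nonempty[OF time] by simp
  next
    case equal
    then show ?thesis using two unfolding two_photons_meeting_once_def by blast
  next
    case greater
    then show ?thesis unfolding T using indefinite_proj_null_nonempty[OF space] by simp
  qed
  \<comment> \<open>The range of \<open>\<bar>a\<bar>\<close> determines which kind of intersection
    occurs; mutual exclusion turns these three implications into equivalences.\<close>
  note exclusive = spacelike_circle_not_two_photons timelike_circle_not_two_photons
    spacelike_circle_not_timelike_circle
  show ?thesis
    unfolding Let_def eta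
    using nonempty two spacelike timelike transverse exclusive[of "T1 \<inter> T2"]
    by (cases "\<bar>a\<bar>" "1 :: real" rule: linorder_cases) auto
qed

end
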